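(* Let $n\in\mathbb{N}$ and $0<t\leq1$. Then $$ \begin{aligned} \sum_{k=1}^{\infty}\frac{H_{k-1}t^k}{k\binom{n+k}{k}}={}&\frac{1}{2}\log^2(1-t)+\frac{t\log(1-t)}{1-t}\sum_{k=1}^{n}\frac{1}{k}\left(\frac{t-1}{t}\right)^k\\ &+\frac{\log^2(1-t)}{2(1-t)}\sum_{k=1}^{n}\left(\frac{t-1}{t}\right)^k-\frac{t}{1-t}\sum_{k=1}^{n}\frac{H_k}{k}\left(\frac{t-1}{t}\right)^k\\ &+\frac{1}{1-t}\sum_{p=0}^{n-1}\left\{\sum_{k=1}^{n-p}\left(\frac{H_{p+k}-H_k}{(p+k)k}+\frac{1}{k^2(p+k)}\right)\right\}p\left(\frac{t-1}{t}\right)^p\\ &-\frac{\log(1-t)}{1-t}\sum_{k=1}^{n}H_k\left(\frac{t-1}{t}\right)^k, \end{aligned} $$ where for $t=1$ the right-hand side is understood as its limit as $t\to1^-$.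
   Context: $\mathbb{N}=\{1,2,3,\dots\}$. $H_m=\sum_{j=1}^m \frac1j$ is the $m$-th harmonic number, with $H_0=0$. $\log^2 x$ means $(\log x)^2$. Infinite series are limits of partial sums. *)

theory Defs
  imports "HOL-Analysis.Analysis"
begin

text \<open>The harmonic numbers are the library's \<^const>\<open>harm\<close>, with \<open>harm 0 = 0\<close>.\<close>

text \<open>The summand of the series for an index \<open>k \<ge> 1\<close>; its value at \<open>k = 0\<close> is never used.\<close>

definition series_term :: "nat \<Rightarrow> real \<Rightarrow> nat \<Rightarrow> real" where
  "series_term n t k = harm (k - 1) * t ^ k / (real k * real ((n + k) choose k))"

text \<open>The closed form, meaningful for \<open>n \<ge> 1\<close> and \<open>0 < t < 1\<close>.  At \<open>t = 1\<close> it divides by zero and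
  takes \<open>ln 0\<close>, so its value there is arbitrary and only its limit from the left is to be used.\<close>

definition closed_form :: "nat \<Rightarrow> real \<Rightarrow> real" where
  "closed_form n t =
     1 / 2 * (ln (1 - t))\<^sup>2
     + t * ln (1 - t) / (1 - t) * (\<Sum>k=1..n. 1 / real k * ((t - 1) / t) ^ k)
     + (ln (1 - t))\<^sup>2 / (2 * (1 - t)) * (\<Sum>k=1..n. ((t - 1) / t) ^ k)
     - t / (1 - t) * (\<Sum>k=1..n. harm k / real k * ((t - 1) / t) ^ k)
     + 1 / (1 - t) *
         (\<Sum>p=0..n-1.
            (\<Sum>k=1..n-p. (harm (p + k) - harm k) / (real (p + k) * real k)
                          + 1 / ((real k)\<^sup>2 * real (p + k)))
            * real p * ((t - 1) / t) ^ p)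
     - ln (1 - t) / (1 - t) * (\<Sum>k=1..n. harm k * ((t - 1) / t) ^ k)"

end

theory Submission
  imports Defs "HOL-Real_Asymp.Real_Asymp"
begin

text \<open>
  Write \<open>x = (t - 1) / t\<close> and \<open>L = ln (1 - t)\<close>.  With the index shifted to start at \<open>0\<close>, the weight of
  \<open>harm k * t ^ Suc k\<close> in the series is the Beta integral
  \<open>w n k = n! k! / (n + k + 1)!\<close>, and passing from \<open>n\<close> to \<open>n + 1\<close> is a difference in \<open>k\<close>:
  \<open>w (n + 1) k = w n k - w n (k + 1)\<close>.  Shifting the index of a power series divides it by \<open>t\<close>, so
  this difference turns into multiplication by \<open>1 - 1 / t = x\<close>, up to corrections.  For the series
  \<open>E n\<close> without harmonic numbers the correction is its first term, and for the series \<open>F n\<close> of the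
  theorem it comes from \<open>harm (k + 1) - harm k = 1 / (k + 1)\<close>:

    \<open>E (n + 1) = x E n + 1 / (n + 1)\<close> and \<open>F (n + 1) = x F n + E (n + 1) / (n + 1)\<close>,

  starting from \<open>E 0 = - L\<close> and \<open>F 0 = L\<^sup>2 / 2\<close>; the latter is half the Cauchy square of the
  logarithm series.  Solving both recurrences gives
  \<open>F n = x ^ n (L\<^sup>2 / 2 - L harm n) + (\<Sum>q<n. (harm n - harm (n - q - 1)) / (n - q) * x ^ q)\<close>
  (lemma \<open>sums_harm_beta_weight\<close>).

  The stated closed form is this expression in disguise.  Since \<open>1 / (1 - t) = 1 - 1 / x\<close>, the sums
  with this factor can be summed by parts (\<open>summation_by_parts_power\<close>), and comparing coefficients of
  \<open>x ^ q\<close> reduces the claim to an identity between finite harmonic sums,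
  \<open>harm_product_sum_diff\<close>.

  As \<open>t\<close> tends to \<open>1\<close> from the left, \<open>x\<close> tends to \<open>0\<close> and beats the logarithms, so the closed form
  tends to \<open>1 / n\<^sup>2\<close>.  The coefficients of the series are nonnegative, so by monotonicity in \<open>t\<close> the
  series converges at \<open>t = 1\<close> to the same value (\<open>sums_at_one_of_tendsto\<close>).
\<close>

section \<open>Beta weights\<close>

text \<open>The value of the Beta function at \<open>(n + 1, k + 1)\<close>, written with factorials.\<close>

definition beta_weight :: "nat \<Rightarrow> nat \<Rightarrow> real" where
  "beta_weight n k = fact n * fact k / fact (Suc (n + k))"

lemma beta_weight_nonneg: "beta_weight n k \<ge> 0"
  by (simp add: beta_weight_def)

lemma beta_weight_0_left: "beta_weight 0 k = 1 / real (Suc k)"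
  by (simp add: beta_weight_def divide_simps del: of_nat_Suc)

lemma beta_weight_0_right: "beta_weight n 0 = 1 / real (Suc n)"
  by (simp add: beta_weight_def)

text \<open>Under the Beta integral of \<open>u\<^sup>n (1 - u)\<^sup>k\<close> this is \<open>u = 1 - (1 - u)\<close>.  It drives both
  recurrences in \<open>n\<close>.\<close>

lemma beta_weight_Suc_left: "beta_weight (Suc n) k = beta_weight n k - beta_weight n (Suc k)"
proof -
  define X where "X = (fact (n + k) :: real)"
  have "X \<noteq> 0" "1 + (real n + real k) \<noteq> 0" "2 + (real n + real k) \<noteq> 0" by (auto simp: X_def)
  then show ?thesis
    unfolding beta_weight_def by (simp add: X_def [symmetric] divide_simps) (simp add: algebra_simps)
qed

text \<open>Dividing by \<open>k + 1\<close> raises \<open>n\<close>.  In the series with harmonic numbers the increments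
  \<open>1 / (k + 1)\<close> produce exactly this quotient, which is how the series without harmonic numbers
  enters its recurrence.\<close>

lemma beta_weight_Suc_right:
  "beta_weight n (Suc k) / real (Suc k) = beta_weight (Suc n) k / real (Suc n)"
  unfolding beta_weight_def add_Suc_right add_Suc fact_Suc [of k] fact_Suc [of n]
  by (simp del: fact_Suc of_nat_Suc)

lemma series_term_eq_beta_weight:
  "series_term n t (Suc k) = harm k * beta_weight n k * t ^ Suc k"
proof -
  have "real ((n + Suc k) choose Suc k) = fact (Suc (n + k)) / (fact (Suc k) * fact n)"
    using binomial_fact [of "Suc k" "n + Suc k", where 'a=real] by simp
  then show ?thesis
    by (simp add: series_term_def beta_weight_def)
qed

text \<open>For \<open>f k = a k * t ^ Suc k\<close> the summand on the left is \<open>(a k - a (Suc k)) * t ^ Suc k\<close>: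
  differencing the coefficients multiplies the sum by \<open>(t - 1) / t\<close> and adds the first coefficient.\<close>

lemma sums_minus_shift:
  fixes f :: "nat \<Rightarrow> real"
  assumes "f sums s" and "t \<noteq> 0"
  shows "(\<lambda>k. f k - f (Suc k) / t) sums ((t - 1) / t * s + f 0 / t)"
proof -
  have "(\<lambda>k. f k - f (Suc k) / t) sums (s - (s - f 0) / t)"
    using assms(1) by (intro sums_diff sums_divide) (simp_all add: sums_Suc_iff)
  also have "s - (s - f 0) / t = (t - 1) / t * s + f 0 / t"
    using assms(2) by (simp add: field_simps)
  finally show ?thesis .
qed

section \<open>The logarithm series and its square\<close>

lemma sums_ln_one_minus:
  fixes t :: real
  assumes "0 < t" "t < 1"
  shows "(\<lambda>k. t ^ Suc k / real (Suc k)) sums (- ln (1 - t))"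
proof -
  have "(\<lambda>n. - ((-(-t)) ^ n) / of_nat n) sums ln (1 + (-t))"
    using assms by (intro ln_series') auto
  then have "(\<lambda>n. t ^ n / of_nat n) sums (- ln (1 - t))"
    using sums_minus by fastforce
  then show ?thesis
    by (subst sums_Suc_iff) simp
qed

text \<open>Partial fractions: the two factors in each denominator add up to \<open>k + 2\<close>, so each summand
  splits into two reciprocals, and reversing the order of the second sum gives the first.\<close>

lemma sum_inverse_products_eq_harm:
  "(\<Sum>i\<le>k. 1 / (real (Suc i) * real (Suc (k - i)))) = 2 * harm (Suc k) / real (k + 2)"
proof -
  have "(\<Sum>i\<le>k. 1 / (real (Suc i) * real (Suc (k - i))))
      = (\<Sum>i\<le>k. (1 / real (Suc i) + 1 / real (Suc (k - i))) / real (k + 2))"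
    by (intro sum.cong refl) (auto simp: of_nat_diff divide_simps)
  also have "\<dots> = ((\<Sum>i\<le>k. 1 / real (Suc i)) + (\<Sum>i\<le>k. 1 / real (Suc (k - i)))) / real (k + 2)"
    by (simp add: sum.distrib flip: sum_divide_distrib)
  also have "(\<Sum>i\<le>k. 1 / real (Suc (k - i))) = (\<Sum>i\<le>k. 1 / real (Suc i))"
    using sum.nat_diff_reindex [of "\<lambda>i. 1 / real (Suc i)" "Suc k"]
    by (simp add: lessThan_Suc_atMost)
  also have "(\<Sum>i\<le>k. 1 / real (Suc i)) = harm (Suc k)"
    unfolding harm_def One_nat_def sum.atLeast1_atMost_eq by (simp add: lessThan_Suc_atMost inverse_eq_divide)
  finally show ?thesis by simp
qed

text \<open>The Cauchy square of the series of \<open>- ln (1 - t)\<close>, whose coefficients are the sums just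
  computed.  It starts at \<open>t\<^sup>2\<close>, hence the shift of index by one, harmless because \<open>harm 0 = 0\<close>.\<close>

lemma sums_harm_eq_ln_squared:
  fixes t :: real
  assumes "0 < t" "t < 1"
  shows "(\<lambda>k. harm k * t ^ Suc k / real (Suc k)) sums ((ln (1 - t))\<^sup>2 / 2)"
proof -
  let ?a = "\<lambda>k. t ^ Suc k / real (Suc k)"
  have sums: "?a sums (- ln (1 - t))"
    using assms by (rule sums_ln_one_minus)
  have norm: "(\<lambda>k. norm (?a k)) = ?a"
    using assms by (auto simp: fun_eq_iff)
  have "(\<lambda>k. \<Sum>i\<le>k. ?a i * ?a (k - i)) sums ((\<Sum>k. ?a k) * (\<Sum>k. ?a k))"
    by (rule Cauchy_product_sums) (use sums norm in \<open>auto simp: sums_iff\<close>)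
  also have "(\<lambda>k. \<Sum>i\<le>k. ?a i * ?a (k - i))
      = (\<lambda>k. 2 * (harm (Suc k) * t ^ Suc (Suc k) / real (Suc (Suc k))))"
  proof
    fix k
    have "(\<Sum>i\<le>k. ?a i * ?a (k - i))
        = (\<Sum>i\<le>k. t ^ (k + 2) * (1 / (real (Suc i) * real (Suc (k - i)))))"
    proof (intro sum.cong refl)
      fix i assume "i \<in> {..k}"
      then have "t ^ (k + 2) = t ^ Suc i * t ^ Suc (k - i)"
        by (simp flip: power_add)
      then show "?a i * ?a (k - i) = t ^ (k + 2) * (1 / (real (Suc i) * real (Suc (k - i))))"
        by (simp only: times_divide_times_eq times_divide_eq_right times_divide_eq_left divide_divide_eq_left mult_1_right mult.commute)
    qed
    also have "\<dots> = 2 * (harm (Suc k) * t ^ Suc (Suc k) / real (Suc (Suc k)))"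
      by (simp only: sum_inverse_products_eq_harm flip: sum_distrib_left) simp
    finally show "(\<Sum>i\<le>k. ?a i * ?a (k - i)) = \<dots>" .
  qed
  also have "(\<Sum>k. ?a k) * (\<Sum>k. ?a k) = 2 * ((ln (1 - t))\<^sup>2 / 2)"
    using sums by (simp add: sums_iff power2_eq_square)
  finally have "(\<lambda>k. harm (Suc k) * t ^ Suc (Suc k) / real (Suc (Suc k))) sums ((ln (1 - t))\<^sup>2 / 2)"
    by (subst (asm) sums_mult_iff) auto
  then show ?thesis
    by (subst (asm) sums_Suc_iff) (simp add: harm_expand)
qed

section \<open>Summing the series for \<open>t < 1\<close>\<close>

text \<open>By induction on \<open>n\<close>: each step multiplies by \<open>x\<close> and adds the first coefficient
  \<open>beta_weight n 0 = 1 / (n + 1)\<close>.\<close>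

lemma sums_beta_weight:
  fixes t :: real
  assumes "0 < t" "t < 1"
  defines "x \<equiv> (t - 1) / t"
  shows "(\<lambda>k. beta_weight n k * t ^ Suc k) sums
           (- ln (1 - t) * x ^ n + (\<Sum>q<n. x ^ q / real (n - q)))"
proof (induction n)
  case 0
  show ?case using sums_ln_one_minus [OF assms(1,2)] by (simp add: beta_weight_0_left)
next
  case (Suc n)
  let ?S = "- ln (1 - t) * x ^ n + (\<Sum>q<n. x ^ q / real (n - q))"
  have "(\<lambda>k. beta_weight n k * t ^ Suc k - beta_weight n (Suc k) * t ^ Suc (Suc k) / t) sums
          (x * ?S + beta_weight n 0 * t ^ Suc 0 / t)"
    unfolding x_def using assms by (intro sums_minus_shift Suc.IH [unfolded x_def]) auto
  also have "(\<lambda>k. beta_weight n k * t ^ Suc k - beta_weight n (Suc k) * t ^ Suc (Suc k) / t)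
      = (\<lambda>k. beta_weight (Suc n) k * t ^ Suc k)"
    using assms by (simp add: fun_eq_iff beta_weight_Suc_left algebra_simps)
  also have "x * ?S + beta_weight n 0 * t ^ Suc 0 / t
      = - ln (1 - t) * x ^ Suc n + (\<Sum>q<Suc n. x ^ q / real (Suc n - q))"
    using assms(1)
    by (simp add: beta_weight_0_right sum.lessThan_Suc_shift sum_distrib_left ring_distribs mult_ac
        del: sum.lessThan_Suc of_nat_Suc of_nat_diff)
  finally show ?case .
qed

text \<open>The closed form expanded in powers of \<open>x = (t - 1) / t\<close>.  Unlike the original expression it has
  no factor \<open>1 / (1 - t)\<close>, which makes its limit at \<open>t = 1\<close> visible.\<close>

definition reduced_form :: "nat \<Rightarrow> real \<Rightarrow> real" where
  "reduced_form n t =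
     ((t - 1) / t) ^ n * ((ln (1 - t))\<^sup>2 / 2 - ln (1 - t) * harm n)
     + (\<Sum>q<n. (harm n - harm (n - Suc q)) / real (n - q) * ((t - 1) / t) ^ q)"

text \<open>By induction on \<open>n\<close>.  Differencing the weights now leaves an extra
  \<open>beta_weight n (Suc k) / Suc k\<close> from the increment of the harmonic number; it equals
  \<open>beta_weight (Suc n) k / Suc n\<close>, a summand of the previous lemma.\<close>

lemma sums_harm_beta_weight:
  fixes t :: real
  assumes "0 < t" "t < 1"
  shows "(\<lambda>k. harm k * beta_weight n k * t ^ Suc k) sums reduced_form n t"
proof (induction n)
  case 0
  show ?case using sums_harm_eq_ln_squared [OF assms]
    by (simp add: beta_weight_0_left reduced_form_def harm_expand)
next
  case (Suc n)
  define x where "x = (t - 1) / t"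
  let ?f = "\<lambda>n k. harm k * beta_weight n k * t ^ Suc k"
  let ?e = "\<lambda>n k. beta_weight n k * t ^ Suc k"
  let ?E = "- ln (1 - t) * x ^ Suc n + (\<Sum>q<Suc n. x ^ q / real (Suc n - q))"
  have "(\<lambda>k. (?f n k - ?f n (Suc k) / t) + ?e (Suc n) k / real (Suc n)) sums
          ((x * reduced_form n t + ?f n 0 / t) + ?E / real (Suc n))"
    unfolding x_def using assms
    by (intro sums_add sums_divide sums_minus_shift Suc.IH sums_beta_weight) auto
  also have "(\<lambda>k. (?f n k - ?f n (Suc k) / t) + ?e (Suc n) k / real (Suc n)) = ?f (Suc n)"
  proof
    fix k
    have "?e (Suc n) k / real (Suc n) = (beta_weight (Suc n) k / real (Suc n)) * t ^ Suc k"
      by simp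
    also have "\<dots> = beta_weight n (Suc k) / real (Suc k) * t ^ Suc k"
      by (simp only: beta_weight_Suc_right)
    finally have e: "?e (Suc n) k / real (Suc n) = beta_weight n (Suc k) / real (Suc k) * t ^ Suc k" .
    have h: "harm (Suc k) = harm k + 1 / real (Suc k)"
      by (simp add: harm_Suc inverse_eq_divide)
    have f: "?f n (Suc k) / t = (harm k + 1 / real (Suc k)) * beta_weight n (Suc k) * t ^ Suc k"
      unfolding h using assms(1) by simp
    show "(?f n k - ?f n (Suc k) / t) + ?e (Suc n) k / real (Suc n) = ?f (Suc n) k"
      unfolding e f unfolding beta_weight_Suc_left by (simp add: ring_distribs del: of_nat_Suc)
  qed
  also have "(x * reduced_form n t + ?f n 0 / t) + ?E / real (Suc n) = reduced_form (Suc n) t"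
  proof -
    let ?L = "ln (1 - t)"
    have h: "harm (Suc n) = harm n + 1 / real (Suc n)"
      by (simp add: harm_Suc inverse_eq_divide)
    have a: "x ^ Suc n * (?L\<^sup>2 / 2 - ?L * harm (Suc n))
        = x * (x ^ n * (?L\<^sup>2 / 2 - ?L * harm n)) + (- ?L * x ^ Suc n) / real (Suc n)"
      unfolding h by (simp add: right_diff_distrib distrib_left mult_ac del: of_nat_Suc)
    have b: "(\<Sum>q<Suc n. (harm (Suc n) - harm (Suc n - Suc q)) / real (Suc n - q) * x ^ q)
        = x * (\<Sum>q<n. (harm n - harm (n - Suc q)) / real (n - q) * x ^ q)
          + (\<Sum>q<Suc n. x ^ q / real (Suc n - q)) / real (Suc n)"
    proof -
      have "(\<Sum>q<Suc n. (harm (Suc n) - harm (Suc n - Suc q)) / real (Suc n - q) * x ^ q)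
         = (\<Sum>q<Suc n. (harm n - harm (n - q)) / real (Suc n - q) * x ^ q)
          + (\<Sum>q<Suc n. x ^ q / real (Suc n - q)) / real (Suc n)"
        unfolding h sum_divide_distrib sum.distrib [symmetric]
        by (intro sum.cong refl)
           (simp add: ring_distribs diff_divide_distrib add_divide_distrib mult_ac del: of_nat_Suc)
      also have "(\<Sum>q<Suc n. (harm n - harm (n - q)) / real (Suc n - q) * x ^ q)
         = x * (\<Sum>q<n. (harm n - harm (n - Suc q)) / real (n - q) * x ^ q)"
        by (simp add: sum.lessThan_Suc_shift sum_distrib_left mult_ac del: sum.lessThan_Suc)
      finally show ?thesis .
    qed
    show ?thesis
      unfolding reduced_form_def x_def [symmetric] a b
      by (simp only: add_divide_distrib distrib_left harm_expand mult_zero_left div_0 add_0_right add_ac)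
  qed
  finally show ?case .
qed

section \<open>Reduction of the closed form\<close>

text \<open>The factor \<open>1 - 1 / x\<close> turns \<open>x ^ k\<close> into \<open>x ^ k - x ^ (k - 1)\<close>.  It is the factor
  \<open>1 / (1 - t)\<close> of the closed form, so the lemma removes that factor from the sums there.\<close>

lemma summation_by_parts_power:
  fixes g :: "nat \<Rightarrow> real"
  assumes "x \<noteq> 0"
  shows "(1 - 1 / x) * (\<Sum>k=1..n. g k * x ^ k)
           = g n * x ^ n - g 0 - (\<Sum>q<n. (g (Suc q) - g q) * x ^ q)"
proof (induction n)
  case 0
  show ?case by simp
next
  case (Suc n)
  have "(1 - 1 / x) * x ^ Suc n = x ^ Suc n - x ^ n"
    using assms by (simp add: left_diff_distrib)
  then have "(1 - 1 / x) * (g (Suc n) * x ^ Suc n) = g (Suc n) * (x ^ Suc n - x ^ n)"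
    by (simp only: mult.left_commute)
  with Suc.IH show ?case
    by (simp add: ring_distribs del: power_Suc)
qed

text \<open>The sum \<open>A p (n - p)\<close> is the coefficient of \<open>x ^ p\<close> in the double sum of the closed form, and
  summation by parts needs the difference of consecutive coefficients.  Enlarging \<open>m\<close> by one appends
  one summand to each of the two sums, both with the same index \<open>p + k = q + m + 2\<close>, so the
  products with \<open>1 / (q + m + 2)\<close> leave only \<open>1 / ((m + 1) (q + m + 2))\<close>.  This is what replaces
  \<open>harm (q + m + 2)\<close> by \<open>harm (q + m + 1)\<close> over \<open>m + 1\<close>, and the rest is the increment of the
  right-hand side.\<close>

lemma harm_product_sum_diff:
  defines "A \<equiv> \<lambda>p m. \<Sum>k=1..m. (harm (p + k) - harm (k - 1)) * (1 / real k - 1 / real (p + k))"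
  shows "A q (Suc m) - A (Suc q) m
           = (harm (q + Suc m) - harm m) / real (Suc m) - harm (Suc q) / real (Suc q)"
proof (induction m)
  case 0
  show ?case by (simp add: A_def harm_expand algebra_simps)
next
  case (Suc m)
  have 1: "A q (Suc (Suc m)) = A q (Suc m)
      + (harm (q + Suc (Suc m)) - harm (Suc m)) * (1 / real (Suc (Suc m)) - 1 / real (q + Suc (Suc m)))"
    by (simp add: A_def)
  have 2: "A (Suc q) (Suc m) = A (Suc q) m
      + (harm (q + Suc (Suc m)) - harm m) * (1 / real (Suc m) - 1 / real (q + Suc (Suc m)))"
    by (simp add: A_def)
  have h1: "harm (q + Suc (Suc m)) = harm (q + Suc m) + 1 / real (q + Suc (Suc m))"
    by (simp add: harm_Suc inverse_eq_divide)
  have h2: "harm (Suc m) = harm m + 1 / real (Suc m)"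
    by (simp add: harm_Suc inverse_eq_divide)
  show ?case
    using Suc.IH unfolding 1 2 h1 h2 by (simp add: algebra_simps diff_divide_distrib add_divide_distrib)
qed

text \<open>Partial fractions: \<open>p / (k (p + k)) = 1 / k - 1 / (p + k)\<close>, and the term with \<open>k\<^sup>2\<close> turns
  \<open>harm k\<close> into \<open>harm (k - 1)\<close>.\<close>

lemma inner_sum_eq:
  "(\<Sum>k=1..m. (harm (p + k) - harm k) / (real (p + k) * real k) + 1 / ((real k)\<^sup>2 * real (p + k))) * real p
     = (\<Sum>k=1..m. (harm (p + k) - harm (k - 1)) * (1 / real k - 1 / real (p + k)))"
  unfolding sum_distrib_right
proof (intro sum.cong refl)
  fix k :: nat assume "k \<in> {1..m}"
  then obtain j where k: "k = Suc j" by (cases k) auto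
  have h: "harm (k - 1) = harm k - 1 / real k"
    by (simp add: k harm_Suc inverse_eq_divide)
  have "real k > 0" "real p + real k > 0" by (auto simp: k add_nonneg_pos)
  then show "((harm (p + k) - harm k) / (real (p + k) * real k) + 1 / ((real k)\<^sup>2 * real (p + k))) * real p
      = (harm (p + k) - harm (k - 1)) * (1 / real k - 1 / real (p + k))"
    unfolding h by (simp add: divide_simps power2_eq_square) (simp add: algebra_simps)
qed

text \<open>The powers of \<open>L = ln (1 - t)\<close> separate.  At \<open>L\<^sup>2\<close> a geometric sum telescopes (\<open>P1\<close>); at \<open>L\<close> and
  at \<open>1\<close> the boundary terms and increments from \<open>P2\<close> and \<open>P3\<close> cancel the remaining sums with
  factor \<open>t / (1 - t) = - 1 / x\<close>.\<close>

lemma closed_form_eq_reduced_form: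
  fixes t :: real
  assumes "n \<ge> 1" "0 < t" "t < 1"
  shows "closed_form n t = reduced_form n t"
proof -
  define x where "x = (t - 1) / t"
  define L where "L = ln (1 - t)"
  define c where "c p = (\<Sum>k=1..n-p. (harm (p + k) - harm (k - 1)) * (1 / real k - 1 / real (p + k)))" for p
  have x: "x \<noteq> 0" "1 / (1 - t) = 1 - 1 / x" "t / (1 - t) = - 1 / x"
    using assms by (auto simp: x_def field_simps)
  \<comment> \<open>The range changes for free: \<open>c 0 = 0\<close>, and \<open>c n = 0\<close> as an empty sum.\<close>
  have c_sum: "(\<Sum>p=0..n-1. (\<Sum>k=1..n-p. (harm (p + k) - harm k) / (real (p + k) * real k)
                          + 1 / ((real k)\<^sup>2 * real (p + k))) * real p * x ^ p)
      = (\<Sum>k=1..n. c k * x ^ k)"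
  proof -
    have "(\<Sum>p=0..n-1. c p * x ^ p) = (\<Sum>k=1..n. c k * x ^ k)"
      using assms(1) by (intro sum.mono_neutral_cong) (auto simp: c_def not_le)
    then show ?thesis
      by (simp only: inner_sum_eq c_def)
  qed
  have c_diff: "c (Suc q) - c q = harm (Suc q) / real (Suc q) - (harm n - harm (n - Suc q)) / real (n - q)"
    if "q < n" for q
    using harm_product_sum_diff [of q "n - Suc q"] that by (simp add: c_def Suc_diff_Suc)
  have c_ends: "c 0 = 0" "c n = 0" by (auto simp: c_def)
  have shift: "(\<Sum>k=1..n. g k * x ^ k) / x = (\<Sum>q<n. g (Suc q) * x ^ q)" for g :: "nat \<Rightarrow> real"
    unfolding One_nat_def sum.atLeast1_atMost_eq using x(1) by (simp add: sum_divide_distrib)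
  have P1: "(1 - 1 / x) * (\<Sum>k=1..n. x ^ k) = x ^ n - 1"
    using summation_by_parts_power [OF x(1), of "\<lambda>_. 1" n] by simp
  have P2: "(1 - 1 / x) * (\<Sum>k=1..n. harm k * x ^ k)
      = harm n * x ^ n - (\<Sum>k=1..n. 1 / real k * x ^ k) / x"
    using summation_by_parts_power [OF x(1), of harm n] shift [of "\<lambda>k. 1 / real k"]
    by (simp add: harm_Suc inverse_eq_divide harm_expand)
  have P3: "(1 - 1 / x) * (\<Sum>k=1..n. c k * x ^ k)
      = (\<Sum>q<n. (harm n - harm (n - Suc q)) / real (n - q) * x ^ q)
        - (\<Sum>k=1..n. harm k / real k * x ^ k) / x"
  proof -
    have "(\<Sum>q<n. (c (Suc q) - c q) * x ^ q)
        = (\<Sum>q<n. (harm (Suc q) / real (Suc q) - (harm n - harm (n - Suc q)) / real (n - q)) * x ^ q)"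
      by (intro sum.cong refl) (simp add: c_diff)
    then show ?thesis
      unfolding shift
      using summation_by_parts_power [OF x(1), of c n] by (simp add: c_ends left_diff_distrib sum_subtractf)
  qed
  have "closed_form n t =
     1 / 2 * L\<^sup>2 + t / (1 - t) * L * (\<Sum>k=1..n. 1 / real k * x ^ k)
     + L\<^sup>2 / 2 * (1 / (1 - t) * (\<Sum>k=1..n. x ^ k))
     - t / (1 - t) * (\<Sum>k=1..n. harm k / real k * x ^ k)
     + 1 / (1 - t) * (\<Sum>k=1..n. c k * x ^ k)
     - L * (1 / (1 - t) * (\<Sum>k=1..n. harm k * x ^ k))"
    unfolding closed_form_def x_def [symmetric] L_def [symmetric] c_sum by simp
  also have "\<dots> = x ^ n * (L\<^sup>2 / 2 - L * harm n)
     + (\<Sum>q<n. (harm n - harm (n - Suc q)) / real (n - q) * x ^ q)"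
    unfolding x(2,3) P1 P2 P3 by (simp add: ring_distribs diff_divide_distrib mult_ac)
  also have "\<dots> = reduced_form n t"
    by (simp add: reduced_form_def x_def L_def)
  finally show ?thesis .
qed

section \<open>The endpoint \<open>t = 1\<close>\<close>

text \<open>For \<open>n \<ge> 1\<close> one factor \<open>x\<close> absorbs the logarithms.  In the sum only \<open>q = 0\<close> survives, with
  coefficient \<open>(harm n - harm (n - 1)) / n\<close>.\<close>

lemma reduced_form_tendsto:
  assumes "n \<ge> 1"
  shows "(reduced_form n \<longlongrightarrow> 1 / (real n)\<^sup>2) (at_left 1)"
proof -
  obtain m where n: "n = Suc m" using assms by (cases n) auto
  let ?x = "\<lambda>t::real. (t - 1) / t"
  have x: "(?x \<longlongrightarrow> 0) (at_left 1)" by real_asymp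
  have log: "((\<lambda>t. ?x t * ((ln (1 - t))\<^sup>2 / 2 - ln (1 - t) * h)) \<longlongrightarrow> 0) (at_left 1)" for h
  proof -
    have 1: "((\<lambda>t. ?x t * ((ln (1 - t))\<^sup>2 / 2)) \<longlongrightarrow> 0) (at_left 1)" by real_asymp
    have 2: "((\<lambda>t. ?x t * ln (1 - t)) \<longlongrightarrow> 0) (at_left 1)" by real_asymp
    show ?thesis
      using tendsto_diff [OF 1 tendsto_mult_right [OF 2, of h]] by (simp add: algebra_simps)
  qed
  have "(reduced_form n \<longlongrightarrow> 0 ^ m * 0
      + (\<Sum>q<n. (harm n - harm (n - Suc q)) / real (n - q) * 0 ^ q)) (at_left 1)"
    unfolding reduced_form_def
    by (simp only: n power_Suc2 mult.assoc) (intro tendsto_intros x log)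
  also have "0 ^ m * 0 + (\<Sum>q<n. (harm n - harm (n - Suc q)) / real (n - q) * 0 ^ q) = 1 / (real n)\<^sup>2"
    by (simp add: n sum.lessThan_Suc_shift harm_Suc power2_eq_square inverse_eq_divide del: sum.lessThan_Suc)
  finally show ?thesis .
qed

text \<open>The endpoint case of monotone convergence.  Each partial sum at \<open>1\<close> is a limit of partial sums
  at \<open>t < 1\<close>, which are at most \<open>f t\<close>; this bounds the series by \<open>l\<close>.  Conversely \<open>f t\<close> is at
  most the sum at \<open>1\<close>.\<close>

lemma sums_at_one_of_tendsto:
  fixes c :: "nat \<Rightarrow> real"
  assumes nonneg: "\<And>k. c k \<ge> 0"
    and sums: "\<And>t. 0 < t \<Longrightarrow> t < 1 \<Longrightarrow> (\<lambda>k. c k * t ^ Suc k) sums f t"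
    and lim: "(f \<longlongrightarrow> l) (at_left 1)"
  shows "c sums l"
proof -
  have near: "\<forall>\<^sub>F t in at_left (1::real). 0 < t \<and> t < 1"
    using eventually_at_left_real [of 0 "1::real"] by (auto elim: eventually_mono)
  have partial: "(\<Sum>k<N. c k) \<le> l" for N
  proof (rule tendsto_le [OF _ lim])
    have "((\<lambda>t. \<Sum>k<N. c k * t ^ Suc k) \<longlongrightarrow> (\<Sum>k<N. c k * 1 ^ Suc k)) (at_left 1)"
      by (intro tendsto_intros)
    then show "((\<lambda>t. \<Sum>k<N. c k * t ^ Suc k) \<longlongrightarrow> (\<Sum>k<N. c k)) (at_left 1)"
      by simp
    show "\<forall>\<^sub>F t in at_left 1. (\<Sum>k<N. c k * t ^ Suc k) \<le> f t"
      using near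
    proof eventually_elim
      case (elim t)
      then have "sum (\<lambda>k. c k * t ^ Suc k) {..<N} \<le> (\<Sum>k. c k * t ^ Suc k)"
        using sums [of t] nonneg by (intro sum_le_suminf) (auto simp: sums_iff)
      with elim sums [of t] show ?case by (simp only: sums_iff simp_thms)
    qed
  qed simp
  have summable: "summable c"
    using nonneg partial by (rule summableI_nonneg_bounded)
  have "suminf c \<le> l"
    using summable partial by (rule suminf_le_const)
  moreover have "l \<le> suminf c"
  proof (rule tendsto_upperbound [OF lim])
    show "\<forall>\<^sub>F t in at_left 1. f t \<le> suminf c"
      using near
    proof eventually_elim
      case (elim t)
      then have "c k * t ^ Suc k \<le> c k" for k
        using nonneg [of k] by (intro mult_left_le power_le_one) auto
      then have "(\<Sum>k. c k * t ^ Suc k) \<le> suminf c"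
        using sums [of t] elim summable by (intro suminf_le) (auto simp: sums_iff)
      with elim sums [of t] show ?case by (simp only: sums_iff simp_thms)
    qed
  qed simp
  ultimately show ?thesis
    using summable by (simp add: sums_iff)
qed

theorem theorem2p12:
  fixes n :: nat and t :: real
  assumes "n \<ge> 1" and "0 < t" and "t \<le> 1"
  shows "summable (\<lambda>k. series_term n t (Suc k)) \<and>
         (if t < 1
          then (\<Sum>k. series_term n t (Suc k)) = closed_form n t
          else (closed_form n \<longlongrightarrow> (\<Sum>k. series_term n t (Suc k))) (at_left 1))"
proof (cases "t < 1")
  case True
  then have "(\<lambda>k. series_term n t (Suc k)) sums closed_form n t"
    using assms closed_form_eq_reduced_form sums_harm_beta_weight
    by (simp only: series_term_eq_beta_weight)
  with True show ?thesis by (simp add: sums_iff)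
next
  case False
  with assms have t: "t = 1" by simp
  have "(\<lambda>k. harm k * beta_weight n k) sums (1 / (real n)\<^sup>2)"
  proof (rule sums_at_one_of_tendsto)
    show "0 \<le> harm k * beta_weight n k" for k
      by (intro mult_nonneg_nonneg harm_nonneg beta_weight_nonneg)
  qed (fact sums_harm_beta_weight reduced_form_tendsto [OF assms(1)])+
  then have sums: "(\<lambda>k. series_term n t (Suc k)) sums (1 / (real n)\<^sup>2)"
    by (simp add: series_term_eq_beta_weight t)
  have "\<forall>\<^sub>F s in at_left 1. reduced_form n s = closed_form n s"
    using eventually_at_left_real [of 0 "1::real"] assms(1)
    by (auto elim!: eventually_mono simp: closed_form_eq_reduced_form)
  then have "(closed_form n \<longlongrightarrow> 1 / (real n)\<^sup>2) (at_left 1)"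
    using reduced_form_tendsto [OF assms(1)] by (simp add: tendsto_cong)
  with False sums show ?thesis by (simp add: sums_iff)
qed

end
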